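(* A sufficient condition for $g_{p_1,p_2}$ to be unimodal is $(p_1,p_2)\in D$, where $$D=\left\{(p_1,p_2)\in[0,1]^2:\ 12p_1p_2\left(p_1+p_2-p_1p_2\right)-14p_1p_2+p_1^2+p_2^2\leq 0\right\}$$ is a closed convex subset of $C$, and $C\subset[0,1]^2$ is the set defined in the context.
   Context: For $(p_1,p_2)\in[0,1]^2$ define $$g_{p_1,p_2}(t)=\frac{1}{t^2}\log\left[e^{-t(p_1+p_2)}\left(1+p_1(e^t-1)\right)\left(1+p_2(e^t-1)\right)\right],$$ with the value at $t=0$ understood by continuous extension, and $t^*_{p_1,p_2}=\log\left[\frac{1-p_1}{p_1}\cdot\frac{1-p_2}{p_2}\right]$. Unimodal means strictly unimodal: a differentiable function $f:\mathbb{R}\to\mathbb{R}$ is strictly unimodal if there exists $x\in\mathbb{R}$ such that $f'$ is positive on $(-\infty,x)$ and negative on $(x,\infty)$. The set $C$ consists of all $(p_1,p_2)\in[0,1]^2$ such that: if $p_1+p_2<1$, then $g_{p_1,p_2}'(t)>0$ for all $0<t<t^*_{p_1,p_2}$; if $p_1+p_2>1$, then $g_{p_1,p_2}'(t)<0$ for all $t^*_{p_1,p_2}<t<0$; if $p_1+p_2=1$, then $g_{p_1,p_2}$ is unimodal. (Where $p_1+p_2\neq1$ and some $p_i\in\{0,1\}$, $t^*_{p_1,p_2}$ is read as $+\infty$ if $p_1+p_2<1$ and as $-\infty$ if $p_1+p_2>1$.)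
   Formalization: Inclusion in C and unimodality are claimed for D without the corners (0,0) and (1,1): both lie in D, but there g is identically zero, so it is not strictly unimodal and the corners are not in C. Closedness and convexity are for all of D. *)

theory Defs
  imports "HOL-Analysis.Analysis"
begin

definition g_raw :: "real \<Rightarrow> real \<Rightarrow> real \<Rightarrow> real" where
  "g_raw p1 p2 t =
     1 / t\<^sup>2 * ln (exp (- t * (p1 + p2)) * (1 + p1 * (exp t - 1)) * (1 + p2 * (exp t - 1)))"

text \<open>The value at \<open>0\<close> is the limit; it exists (see \<open>g_raw_tendsto\<close> below) for all
  \<open>p1\<close>, \<open>p2\<close> and equals \<open>(p1 (1 - p1) + p2 (1 - p2)) / 2\<close>.\<close>

definition g :: "real \<Rightarrow> real \<Rightarrow> real \<Rightarrow> real" where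
  "g p1 p2 t = (if t = 0 then Lim (at 0) (g_raw p1 p2) else g_raw p1 p2 t)"

text \<open>The logarithm is meaningful only for \<open>p1, p2\<close> strictly between \<open>0\<close> and \<open>1\<close>. If some
  \<open>pi\<close> is \<open>0\<close> or \<open>1\<close>, the value is read as \<open>\<infinity>\<close> or \<open>-\<infinity>\<close>, according to the sign of
  \<open>1 - (p1 + p2)\<close>; the value for \<open>p1 + p2 = 1\<close> is never used.\<close>

definition tstar :: "real \<Rightarrow> real \<Rightarrow> ereal" where
  "tstar p1 p2 =
     (if p1 + p2 < 1 \<and> (p1 \<in> {0, 1} \<or> p2 \<in> {0, 1}) then \<infinity>
      else if p1 + p2 > 1 \<and> (p1 \<in> {0, 1} \<or> p2 \<in> {0, 1}) then - \<infinity>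
      else ereal (ln ((1 - p1) / p1 * ((1 - p2) / p2))))"

definition strictly_unimodal :: "(real \<Rightarrow> real) \<Rightarrow> bool" where
  "strictly_unimodal f \<longleftrightarrow>
     (\<forall>t. f differentiable (at t)) \<and>
     (\<exists>x. (\<forall>t<x. deriv f t > 0) \<and> (\<forall>t>x. deriv f t < 0))"

definition C :: "(real \<times> real) set" where
  "C = {(p1, p2). p1 \<in> {0..1} \<and> p2 \<in> {0..1} \<and>
     (p1 + p2 < 1 \<longrightarrow> (\<forall>t::real. 0 < t \<and> ereal t < tstar p1 p2 \<longrightarrow> deriv (g p1 p2) t > 0)) \<and>
     (p1 + p2 > 1 \<longrightarrow> (\<forall>t::real. tstar p1 p2 < ereal t \<and> t < 0 \<longrightarrow> deriv (g p1 p2) t < 0)) \<and>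
     (p1 + p2 = 1 \<longrightarrow> strictly_unimodal (g p1 p2))}"

definition D :: "(real \<times> real) set" where
  "D = {(p1, p2). p1 \<in> {0..1} \<and> p2 \<in> {0..1} \<and>
     12 * p1 * p2 * (p1 + p2 - p1 * p2) - 14 * p1 * p2 + p1\<^sup>2 + p2\<^sup>2 \<le> 0}"

lemma g_raw_tendsto:
  "(g_raw p1 p2 \<longlongrightarrow> (p1 * (1 - p1) + p2 * (1 - p2)) / 2) (at 0)"
proof -
  have pos: "eventually (\<lambda>t. 1 + p * (exp t - 1) > 0) (nhds (0::real))" for p :: real
  proof -
    have "((\<lambda>t. 1 + p * (exp t - 1)) \<longlongrightarrow> 1 + p * (exp 0 - 1)) (nhds (0::real))"
      by (intro tendsto_intros filterlim_ident)
    then show ?thesis by (simp add: order_tendstoD)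
  qed
  define L where "L = (\<lambda>p t::real. ln (1 + p * (exp t - 1)) - t * p)"
  define L1 where "L1 = (\<lambda>p t::real. p * exp t / (1 + p * (exp t - 1)) - p)"
  have lim: "((\<lambda>t. L p t / t\<^sup>2) \<longlongrightarrow> p * (1 - p) / 2) (at 0)" for p
  proof (rule lhopital[where f' = "L1 p" and g' = "\<lambda>t. 2 * t"])
    have "((\<lambda>t. L1 p t) has_real_derivative p * (1 - p)) (at 0)"
      unfolding L1_def by (auto intro!: derivative_eq_intros simp: algebra_simps power2_eq_square)
    then have "((\<lambda>t. L1 p t / t) \<longlongrightarrow> p * (1 - p)) (at 0)"
      by (simp add: has_field_derivative_iff L1_def)
    then have "((\<lambda>t. (L1 p t / t) / 2) \<longlongrightarrow> p * (1 - p) / 2) (at 0)"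
      by (intro tendsto_intros) auto
    then show "((\<lambda>t. L1 p t / (2 * t)) \<longlongrightarrow> p * (1 - p) / 2) (at 0)"
      by (simp add: mult.commute)
    have "isCont (L p) 0"
      unfolding L_def by (intro continuous_intros) auto
    then show "(L p \<longlongrightarrow> 0) (at 0)"
      by (simp add: isCont_def L_def)
    show "((\<lambda>t. t\<^sup>2) \<longlongrightarrow> 0) (at (0::real))"
      by (rule tendsto_eq_intros | simp)+
    show "eventually (\<lambda>t. (L p has_real_derivative L1 p t) (at t)) (at 0)"
      using pos[of p, THEN filter_leD[OF at_within_le_nhds]]
      by eventually_elim (auto simp: L_def L1_def intro!: derivative_eq_intros)
    show "eventually (\<lambda>t. ((\<lambda>t. t\<^sup>2) has_real_derivative 2 * t) (at t)) (at (0::real))"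
      by (auto intro!: always_eventually derivative_eq_intros)
  qed (auto simp: eventually_at_filter)
  have "((\<lambda>t. L p1 t / t\<^sup>2 + L p2 t / t\<^sup>2) \<longlongrightarrow> p1 * (1 - p1) / 2 + p2 * (1 - p2) / 2) (at 0)"
    by (intro tendsto_add lim)
  moreover have "eventually (\<lambda>t. L p1 t / t\<^sup>2 + L p2 t / t\<^sup>2 = g_raw p1 p2 t) (at 0)"
    using pos[of p1, THEN filter_leD[OF at_within_le_nhds]]
      pos[of p2, THEN filter_leD[OF at_within_le_nhds]]
  proof eventually_elim
    case (elim t)
    define a b where "a = 1 + p1 * (exp t - 1)" and "b = 1 + p2 * (exp t - 1)"
    have "a > 0" "b > 0" using elim by (simp_all only: a_def b_def)
    then have "ln (exp (- t * (p1 + p2)) * a * b) = - t * (p1 + p2) + ln a + ln b"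
      by (simp add: ln_mult_pos)
    also have "\<dots> = L p1 t + L p2 t"
      by (simp only: L_def a_def b_def) (simp add: algebra_simps)
    finally have "ln (exp (- t * (p1 + p2)) * a * b) = L p1 t + L p2 t" .
    then show ?case by (simp only: g_raw_def a_def b_def) (simp add: add_divide_distrib)
  qed
  ultimately show ?thesis
    by (auto simp: add_divide_distrib dest: Lim_transform_eventually)
qed

text \<open>At the corners \<open>(0, 0)\<close> and \<open>(1, 1)\<close>, both of which lie in \<open>D\<close>, the function is
  identically zero, hence not strictly unimodal, and neither corner lies in \<open>C\<close>. So
  any statement that points of \<open>D\<close> lie in \<open>C\<close> or give a unimodal function has to leave
  these two points out.\<close>

lemma g_corners: "g 0 0 = (\<lambda>t. 0)" "g 1 1 = (\<lambda>t. 0)"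
proof -
  have "Lim (at 0) (g_raw 0 0) = 0" "Lim (at 0) (g_raw 1 1) = 0"
    using g_raw_tendsto[of 0 0] g_raw_tendsto[of 1 1] by (simp_all add: tendsto_Lim)
  then show "g 0 0 = (\<lambda>t. 0)" "g 1 1 = (\<lambda>t. 0)"
    by (auto simp: g_def g_raw_def simp flip: exp_add)
qed

lemma corners_in_D: "(0, 0) \<in> D" "(1, 1) \<in> D"
  by (auto simp: D_def)

lemma corners_not_in_C: "(0, 0) \<notin> C" "(1, 1) \<notin> C"
  unfolding C_def tstar_def by (auto simp: g_corners intro: exI[of _ 1] exI[of _ "- 1"])

lemma corners_not_unimodal: "\<not> strictly_unimodal (g 0 0)" "\<not> strictly_unimodal (g 1 1)"
  unfolding strictly_unimodal_def by (auto simp: g_corners intro: lt_ex)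

end

theory Submission
  imports Defs
begin

text \<open>Write \<open>f t = ln (1 + p1 (e\<^sup>t - 1)) - p1 t + ln (1 + p2 (e\<^sup>t - 1)) - p2 t\<close>, so that
  \<open>g = f / t\<^sup>2\<close> and \<open>g' = h / t\<^sup>3\<close> with \<open>h = t f' - 2 f\<close>. Here \<open>h 0 = h' 0 = 0\<close> and
  \<open>h'' = t f'''\<close>. With \<open>u = p1 (1 - p2)\<close> and \<open>v = p2 (1 - p1)\<close>, membership in \<open>D\<close> says
  \<open>(u + v)\<^sup>2 \<le> 16 u v\<close>, which is exactly the condition under which \<open>f'''\<close> changes sign only
  once, at \<open>t\<^sup>* / 2\<close>. Moreover \<open>h\<close> vanishes at \<open>t\<^sup>*\<close>. If \<open>t\<^sup>* \<ge> 0\<close>, then \<open>h\<close> is convex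
  on \<open>[0, t\<^sup>* / 2]\<close> and concave on both remaining half-lines, which determines its sign
  everywhere: \<open>g\<close> is unimodal with mode \<open>t\<^sup>*\<close>. The case \<open>t\<^sup>* < 0\<close> follows by the reflection
  \<open>p \<mapsto> 1 - p\<close>, \<open>t \<mapsto> - t\<close>. The same inequality bounds the odds ratio of \<open>p1\<close> and
  \<open>p2\<close> by \<open>7 + 4 \<surd>3\<close> in both directions, which makes \<open>D\<close> an intersection of two
  hypographs of concave functions.\<close>

section \<open>Functions divided by \<open>t\<^sup>2\<close>\<close>

text \<open>These are the only facts about the sum of cumulants that the calculus argument uses.
  \<open>m\<close> is half of the future mode, and \<open>zero\<close> says that
  \<open>t * f1 t - 2 * f t\<close> vanishes at \<open>2 * m\<close>.\<close>

locale third_derivative_sign =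
  fixes f f1 f2 f3 :: "real \<Rightarrow> real" and m :: real
  assumes df: "\<And>t. (f has_real_derivative f1 t) (at t)"
    and df1: "\<And>t. (f1 has_real_derivative f2 t) (at t)"
    and df2: "\<And>t. (f2 has_real_derivative f3 t) (at t)"
    and f0: "f 0 = 0" and f10: "f1 0 = 0"
    and m0: "m \<ge> 0"
    and f3_pos: "\<And>t. t < m \<Longrightarrow> f3 t > 0"
    and f3_neg: "\<And>t. t > m \<Longrightarrow> f3 t < 0"
    and zero: "2 * m * f1 (2 * m) = 2 * f (2 * m)"
begin

definition h :: "real \<Rightarrow> real" where "h t = t * f1 t - 2 * f t"

definition h1 :: "real \<Rightarrow> real" where "h1 t = t * f2 t - f1 t"

lemma dh: "(h has_real_derivative h1 t) (at t)"
  unfolding h_def h1_def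
  by (auto intro!: derivative_eq_intros df df1 simp: algebra_simps)

lemma dh1: "(h1 has_real_derivative t * f3 t) (at t)"
  unfolding h1_def
  by (auto intro!: derivative_eq_intros df1 df2 simp: algebra_simps)

lemma h_0: "h 0 = 0" "h1 0 = 0" "h (2 * m) = 0"
  using zero by (simp_all add: h_def h1_def f0 f10)

lemma h_mvt:
  assumes "a < b"
  obtains z where "a < z" "z < b" "h b - h a = (b - a) * h1 z"
  using MVT2[of a b h h1] assms dh by blast

lemma h1_mvt:
  assumes "a < b"
  obtains z where "a < z" "z < b" "h1 b - h1 a = (b - a) * (z * f3 z)"
  using MVT2[of a b h1 "\<lambda>t. t * f3 t"] assms dh1 by blast

lemma h1_antimono:
  assumes "m \<le> a" "a < b"
  shows "h1 b < h1 a"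
proof -
  obtain z where z: "a < z" "z < b" "h1 b - h1 a = (b - a) * (z * f3 z)"
    using h1_mvt assms by blast
  then have "z * f3 z < 0"
    using assms m0 by (intro mult_pos_neg f3_neg) auto
  then have "(b - a) * (z * f3 z) < 0"
    using assms by (intro mult_pos_neg[of "b - a"]) auto
  with z show ?thesis by linarith
qed

text \<open>Left of \<open>0 \<le> m\<close> the derivative \<open>t * f3 t\<close> of
  \<open>h1\<close> is negative, so \<open>h1\<close> falls strictly to
  \<open>h1 0 = 0\<close>.\<close>

lemma h1_pos_left:
  assumes "t < 0"
  shows "h1 t > 0"
proof -
  obtain z where z: "t < z" "z < 0" "h1 0 - h1 t = (0 - t) * (z * f3 z)"
    using h1_mvt assms by blast
  then have "z * f3 z < 0"
    using m0 by (intro mult_neg_pos f3_pos) auto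
  then have "(0 - t) * (z * f3 z) < 0"
    using assms by (intro mult_pos_neg[of "0 - t"]) auto
  with z show ?thesis by (simp add: h_0)
qed

lemma h_neg_left:
  assumes "t < 0"
  shows "h t < 0"
proof -
  obtain z where z: "t < z" "z < 0" "h 0 - h t = (0 - t) * h1 z"
    using h_mvt assms by blast
  then have "(0 - t) * h1 z > 0"
    using assms h1_pos_left by (intro mult_pos_pos) auto
  with z show ?thesis by (simp add: h_0)
qed

lemma h1_pos_middle:
  assumes "0 < t" "t \<le> m"
  shows "h1 t > 0"
proof -
  obtain z where z: "0 < z" "z < t" "h1 t - h1 0 = (t - 0) * (z * f3 z)"
    using h1_mvt assms by blast
  then have "(t - 0) * (z * f3 z) > 0"
    using assms f3_pos[of z] by (intro mult_pos_pos) auto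
  with z show ?thesis by (simp add: h_0)
qed

lemma h_pos_middle:
  assumes "0 < t" "t \<le> m"
  shows "h t > 0"
proof -
  obtain z where z: "0 < z" "z < t" "h t - h 0 = (t - 0) * h1 z"
    using h_mvt assms by blast
  then have "(t - 0) * h1 z > 0"
    using assms h1_pos_middle by (intro mult_pos_pos) auto
  with z show ?thesis by (simp add: h_0)
qed

text \<open>Beyond \<open>m\<close> the slope \<open>h1\<close> only decreases, so once it is
  nonpositive it is negative from there on.\<close>

lemma h_decreasing:
  assumes "m \<le> z" "h1 z \<le> 0" "z \<le> a" "a < b"
  shows "h b < h a"
proof -
  obtain y where y: "a < y" "y < b" "h b - h a = (b - a) * h1 y"
    using h_mvt assms by blast
  then have "h1 y < 0"
    using h1_antimono[of z y] assms by auto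
  then have "(b - a) * h1 y < 0"
    using assms by (intro mult_pos_neg) auto
  with y show ?thesis by simp
qed

lemma h_pos:
  assumes "0 < t" "t < 2 * m"
  shows "h t > 0"
proof (cases "t \<le> m")
  case True
  then show ?thesis using h_pos_middle assms by blast
next
  case False
  show ?thesis
  proof (rule ccontr)
    \<comment> \<open>Having dropped from \<open>h m > 0\<close> to a nonpositive value,
      \<open>h\<close> would keep falling strictly and be negative at \<open>2 * m\<close>, where it
      is zero.\<close>
    assume neg: "\<not> h t > 0"
    obtain z where z: "m < z" "z < t" "h t - h m = (t - m) * h1 z"
      using h_mvt[of m t] False by auto
    have "h m > 0"
      using assms by (intro h_pos_middle) auto
    then have "(t - m) * h1 z < 0"
      using z neg by linarith
    then have "h1 z < 0"
      using z by (simp add: mult_less_0_iff)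
    then have "h (2 * m) < h t"
      using z assms by (intro h_decreasing[of z]) auto
    then show False
      using neg h_0 by auto
  qed
qed

lemma h_neg_right:
  assumes "2 * m < t"
  shows "h t < 0"
proof -
  \<comment> \<open>The fall from \<open>h m > 0\<close> to \<open>h (2 * m) = 0\<close> forces a
    negative slope in between. For \<open>m = 0\<close> the interval is a single point, and
    \<open>h1 0 = 0\<close> serves.\<close>
  have "\<exists>z\<ge>m. z \<le> 2 * m \<and> h1 z \<le> 0"
  proof (cases "m = 0")
    case True
    then show ?thesis using h_0 by (intro exI[of _ 0]) auto
  next
    case False
    then have "m < 2 * m" using m0 by auto
    then obtain z where z: "m < z" "z < 2 * m" "h (2 * m) - h m = (2 * m - m) * h1 z"
      using h_mvt by blast
    have "h m > 0"
      using False m0 by (intro h_pos_middle) auto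
    then have "m * h1 z < 0"
      using z h_0 by auto
    then have "h1 z < 0"
      using m0 by (simp add: mult_less_0_iff)
    then show ?thesis using z by (intro exI[of _ z]) auto
  qed
  then obtain z where "z \<ge> m" "z \<le> 2 * m" "h1 z \<le> 0" by blast
  then have "h t < h (2 * m)"
    using assms by (intro h_decreasing[of z]) auto
  then show ?thesis by (simp add: h_0)
qed

section \<open>The quotient \<open>f t / t\<^sup>2\<close> and its derivative, including at the
  origin\<close>

definition G :: "real \<Rightarrow> real" where
  "G t = (if t = 0 then f2 0 / 2 else f t / t\<^sup>2)"

lemma dG:
  assumes "t \<noteq> 0"
  shows "(G has_real_derivative h t / t ^ 3) (at t)"
proof (rule has_field_derivative_transform_within_open)
  show "((\<lambda>t. f t / t\<^sup>2) has_real_derivative h t / t ^ 3) (at t)"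
    unfolding h_def using assms
    by (auto intro!: derivative_eq_intros df
        simp: field_simps power2_eq_square power3_eq_cube)
  show "open (- {0 :: real})" by auto
qed (use assms in \<open>auto simp: G_def\<close>)

text \<open>This is the cubic Taylor coefficient of \<open>f\<close>. Two applications of
  L'Hospital's rule reduce the difference quotient of \<open>G\<close> to that of \<open>f2\<close>,
  whose limit is \<open>f3 0\<close> by definition.\<close>

lemma dG_0: "(G has_real_derivative f3 0 / 6) (at 0)"
proof -
  have l2: "((\<lambda>t. (f2 t - f2 0) / (6 * t)) \<longlongrightarrow> f3 0 / 6) (at 0)"
  proof -
    have "((\<lambda>t. (f2 t - f2 0) / t) \<longlongrightarrow> f3 0) (at 0)"
      using df2[of 0] by (simp add: has_field_derivative_iff)
    then have "((\<lambda>t. (f2 t - f2 0) / t / 6) \<longlongrightarrow> f3 0 / 6) (at 0)"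
      by (intro tendsto_intros) auto
    then show ?thesis by (simp add: mult.commute)
  qed
  have cont: "f \<midarrow>0\<rightarrow> f 0" "f1 \<midarrow>0\<rightarrow> f1 0"
    using DERIV_isCont[OF df] DERIV_isCont[OF df1] by (auto simp: isCont_def)
  have l1: "((\<lambda>t. (f1 t - f2 0 * t) / (3 * t\<^sup>2)) \<longlongrightarrow> f3 0 / 6) (at 0)"
  proof (rule lhopital[OF _ _ _ _ _ _ l2])
    show "((\<lambda>t. f1 t - f2 0 * t) \<longlongrightarrow> 0) (at 0)"
      by (rule tendsto_eq_intros cont | simp add: f10)+
    show "((\<lambda>t. 3 * t\<^sup>2) \<longlongrightarrow> 0) (at (0::real))"
      by (rule tendsto_eq_intros | simp)+
    show "\<forall>\<^sub>F t in at 0. ((\<lambda>t. f1 t - f2 0 * t) has_real_derivative f2 t - f2 0) (at t)"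
      by (intro always_eventually allI) (auto intro!: derivative_eq_intros df1)
    show "\<forall>\<^sub>F t in at 0. ((\<lambda>t. 3 * t\<^sup>2) has_real_derivative 6 * t) (at (t::real))"
      by (intro always_eventually allI) (auto intro!: derivative_eq_intros)
  qed (auto simp: eventually_at_filter)
  have "((\<lambda>t. (f t - f2 0 / 2 * t\<^sup>2) / t ^ 3) \<longlongrightarrow> f3 0 / 6) (at 0)"
  proof (rule lhopital[OF _ _ _ _ _ _ l1])
    show "((\<lambda>t. f t - f2 0 / 2 * t\<^sup>2) \<longlongrightarrow> 0) (at 0)"
    proof -
      have "((\<lambda>t. f t - f2 0 / 2 * t\<^sup>2) \<longlongrightarrow> f 0 - f2 0 / 2 * 0\<^sup>2) (at 0)"
        by (intro tendsto_intros cont)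
      then show ?thesis by (simp add: f0)
    qed
    show "((\<lambda>t. t ^ 3) \<longlongrightarrow> 0) (at (0::real))"
      by (rule tendsto_eq_intros | simp)+
    show "\<forall>\<^sub>F t in at 0. ((\<lambda>t. f t - f2 0 / 2 * t\<^sup>2) has_real_derivative f1 t - f2 0 * t) (at t)"
      by (intro always_eventually allI) (auto intro!: derivative_eq_intros df)
    show "\<forall>\<^sub>F t in at 0. ((\<lambda>t. t ^ 3) has_real_derivative 3 * t\<^sup>2) (at (t::real))"
      by (intro always_eventually allI) (auto intro!: derivative_eq_intros)
  qed (auto simp: eventually_at_filter)
  moreover have "\<forall>\<^sub>F t in at 0. (f t - f2 0 / 2 * t\<^sup>2) / t ^ 3 = (G t - G 0) / (t - 0)"
    by (auto simp: eventually_at_filter G_def field_simps power2_eq_square power3_eq_cube)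
  ultimately show ?thesis
    by (auto simp: has_field_derivative_iff dest: Lim_transform_eventually)
qed

lemma G_unimodal:
  obtains G' where "\<And>t. (G has_real_derivative G' t) (at t)"
    "\<And>t. t < 2 * m \<Longrightarrow> G' t > 0" "\<And>t. t > 2 * m \<Longrightarrow> G' t < 0"
proof
  let ?G' = "\<lambda>t. if t = 0 then f3 0 / 6 else h t / t ^ 3"
  show "(G has_real_derivative ?G' t) (at t)" for t
    using dG dG_0 by auto
  \<comment> \<open>For \<open>t < 0\<close> both \<open>h t\<close> and \<open>t ^ 3\<close> are
    negative. The point \<open>t = 0\<close> is covered only when \<open>m > 0\<close>, and then
    \<open>f3 0 > 0\<close>.\<close>
  show "?G' t > 0" if "t < 2 * m" for t
    using that m0 f3_pos[of t] h_pos[of t] h_neg_left[of t]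
    by (cases t "0 :: real" rule: linorder_cases)
       (auto simp: zero_less_divide_iff zero_less_power_eq power_less_zero_eq)
  show "?G' t < 0" if "t > 2 * m" for t
    using that m0 h_neg_right[of t] by (auto simp: divide_less_0_iff)
qed

end

section \<open>The cumulant functions\<close>

text \<open>The cumulant generating function of a centred Bernoulli variable with success
  probability \<open>p\<close>.\<close>

definition cumulant :: "real \<Rightarrow> real \<Rightarrow> real" where
  "cumulant p t = ln (1 + p * (exp t - 1)) - p * t"

text \<open>The success probability after exponential tilting by \<open>t\<close>; as a function of
  \<open>t\<close> it solves the logistic equation.\<close>

definition tilt :: "real \<Rightarrow> real \<Rightarrow> real" where
  "tilt p t = p * exp t / (1 + p * (exp t - 1))"

lemma mgf_pos:
  fixes p t :: real
  assumes "0 < p" "p < 1"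
  shows "1 + p * (exp t - 1) > 0"
proof -
  have "1 + p * (exp t - 1) = (1 - p) + p * exp t" by (simp add: algebra_simps)
  also have "\<dots> > 0" using assms by (intro add_pos_pos) auto
  finally show ?thesis .
qed

lemma cumulant_0: "cumulant p 0 = 0"
  by (simp add: cumulant_def)

lemma tilt_0: "tilt p 0 = p"
  by (simp add: tilt_def)

lemma cumulant_deriv:
  assumes "0 < p" "p < 1"
  shows "(cumulant p has_real_derivative tilt p t - p) (at t)"
  using mgf_pos[OF assms, of t] unfolding cumulant_def tilt_def
  by (auto intro!: derivative_eq_intros)

lemma tilt_deriv:
  assumes "0 < p" "p < 1"
  shows "(tilt p has_real_derivative tilt p t * (1 - tilt p t)) (at t)"
  using mgf_pos[OF assms, of t] unfolding tilt_def
  by (auto intro!: derivative_eq_intros simp: field_simps power2_eq_square)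

text \<open>Exchanging success and failure negates the centred variable.\<close>

lemma cumulant_reflect:
  assumes "0 < p" "p < 1"
  shows "cumulant (1 - p) t = cumulant p (- t)"
proof -
  have "1 + (1 - p) * (exp t - 1) = exp t * (1 + p * (exp (- t) - 1))"
    by (simp add: algebra_simps exp_minus)
  then have "ln (1 + (1 - p) * (exp t - 1)) = t + ln (1 + p * (exp (- t) - 1))"
    using mgf_pos[OF assms, of "- t"] by (simp add: ln_mult_pos)
  then show ?thesis
    by (simp add: cumulant_def algebra_simps)
qed

lemma g_eq:
  assumes "0 < p1" "p1 < 1" "0 < p2" "p2 < 1"
  shows "g p1 p2 t = (if t = 0 then (p1 * (1 - p1) + p2 * (1 - p2)) / 2
    else (cumulant p1 t + cumulant p2 t) / t\<^sup>2)"
proof (cases "t = 0")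
  case True
  then show ?thesis
    using g_raw_tendsto[of p1 p2] by (simp add: g_def tendsto_Lim)
next
  case False
  define a b where "a = 1 + p1 * (exp t - 1)" and "b = 1 + p2 * (exp t - 1)"
  have "a > 0" "b > 0"
    using mgf_pos assms by (simp_all only: a_def b_def)
  then have "ln (exp (- t * (p1 + p2)) * a * b) = - t * (p1 + p2) + ln a + ln b"
    by (simp add: ln_mult_pos)
  also have "\<dots> = cumulant p1 t + cumulant p2 t"
    by (simp only: cumulant_def a_def b_def) (simp add: algebra_simps)
  finally show ?thesis
    using False by (simp only: g_def g_raw_def a_def b_def) simp
qed

lemma g_reflect:
  assumes "0 < p1" "p1 < 1" "0 < p2" "p2 < 1"
  shows "g (1 - p1) (1 - p2) t = g p1 p2 (- t)"
  using assms by (simp add: g_eq cumulant_reflect algebra_simps)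

text \<open>The third derivatives of the two cumulant functions are
  \<open>p a x (a - p x) / (a + p x)\<^sup>3\<close> with \<open>a = 1 - p\<close> and \<open>x = e\<^sup>t\<close>; this is the numerator
  of their sum.\<close>

lemma skewness_numerator:
  fixes p a q b x :: real
  shows "p * a * (a - p * x) * (b + q * x) ^ 3 + q * b * (b - q * x) * (a + p * x) ^ 3 =
    (a * b - p * q * x\<^sup>2) *
    ((p * b + q * a) * (a * b + p * q * x\<^sup>2) + (8 * (p * b) * (q * a) - (p * b + q * a)\<^sup>2) * x)"
  by (simp add: algebra_simps power2_eq_square power3_eq_cube)

text \<open>With \<open>s = p * b + q * a\<close>, \<open>w\<^sup>2 = a * b\<close> and
  \<open>y\<^sup>2 = p * q\<close>, the expression is \<open>s * (w - y * x)\<^sup>2 + x * (4 * w *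
  y - s) * (2 * w * y + s)\<close>. Here \<open>le\<close> says \<open>s \<le> 4 * w * y\<close>,
  and \<open>ne\<close> keeps the square positive even when equality holds there.\<close>

lemma skewness_factor_pos:
  fixes p a q b x :: real
  assumes pos: "0 < p" "0 < a" "0 < q" "0 < b" "0 < x"
    and le: "(p * b + q * a)\<^sup>2 \<le> 16 * (p * b) * (q * a)"
    and ne: "a * b \<noteq> p * q * x\<^sup>2"
  shows "(p * b + q * a) * (a * b + p * q * x\<^sup>2) + (8 * (p * b) * (q * a) - (p * b + q * a)\<^sup>2) * x > 0"
proof -
  define s w y where "s = p * b + q * a" and "w = sqrt (a * b)" and "y = sqrt (p * q)"
  have wy: "w > 0" "y > 0" "s > 0"
    using pos by (auto simp: w_def y_def s_def add_pos_pos)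
  have w2: "w\<^sup>2 = a * b" and y2: "y\<^sup>2 = p * q"
    using pos by (simp_all add: w_def y_def)
  have uv: "(p * b) * (q * a) = (w * y)\<^sup>2"
    by (simp add: power_mult_distrib w2 y2 algebra_simps)
  have "s\<^sup>2 \<le> (4 * (w * y))\<^sup>2"
    using le uv by (simp add: s_def power_mult_distrib algebra_simps)
  then have s_le: "s \<le> 4 * (w * y)"
    by (rule power2_le_imp_le) (use wy in auto)
  have "w \<noteq> y * x"
    using ne w2 y2 by (auto simp: power_mult_distrib)
  then have "s * (w - y * x)\<^sup>2 > 0"
    using wy by (intro mult_pos_pos) auto
  moreover have "x * ((4 * (w * y) - s) * (2 * (w * y) + s)) \<ge> 0"
    using wy pos s_le by (intro mult_nonneg_nonneg) auto
  moreover have "s * (a * b + p * q * x\<^sup>2) + (8 * (p * b) * (q * a) - s\<^sup>2) * x =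
      s * (w - y * x)\<^sup>2 + x * ((4 * (w * y) - s) * (2 * (w * y) + s))"
    unfolding mult.assoc[of 8] uv w2[symmetric] y2[symmetric]
    by (simp add: algebra_simps power2_eq_square)
  ultimately show ?thesis unfolding s_def by linarith
qed

text \<open>The third central moment of the tilted Bernoulli variable, hence the third derivative of
  \<open>cumulant p\<close>.\<close>

definition skew :: "real \<Rightarrow> real \<Rightarrow> real" where
  "skew p t = tilt p t * (1 - tilt p t) * (1 - 2 * tilt p t)"

lemma variance_deriv:
  assumes "0 < p" "p < 1"
  shows "((\<lambda>t. tilt p t * (1 - tilt p t)) has_real_derivative skew p t) (at t)"
  unfolding skew_def
  by (auto intro!: derivative_eq_intros tilt_deriv[OF assms] simp: algebra_simps)

lemma skew_eq:
  assumes "0 < p" "p < 1"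
  shows "skew p t = exp t * (p * (1 - p) * (1 - p - p * exp t)) / (1 - p + p * exp t) ^ 3"
proof -
  define n x where "n = 1 - p + p * exp t" and "x = exp t"
  have n: "n > 0" "1 + p * (exp t - 1) = n"
    using mgf_pos[OF assms, of t] by (simp_all add: n_def algebra_simps)
  have "1 - p * x / n = (1 - p) / n" "1 - 2 * (p * x / n) = (1 - p - p * x) / n"
    using n by (simp_all add: n_def x_def field_simps)
  then have "skew p t = (p * x / n) * ((1 - p) / n) * ((1 - p - p * x) / n)"
    unfolding skew_def tilt_def n x_def by simp
  also have "\<dots> = x * (p * (1 - p) * (1 - p - p * x)) / n ^ 3"
    by (simp add: power3_eq_cube mult_ac)
  finally show ?thesis
    unfolding n_def x_def .
qed

text \<open>Over a common denominator, \<open>skewness_numerator\<close> splits off the displayed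
  factor; \<open>c\<close> collects the positive remainder.\<close>

lemma skew_sum:
  assumes p: "0 < p1" "p1 < 1" "0 < p2" "p2 < 1"
    and le: "(p1 * (1 - p2) + p2 * (1 - p1))\<^sup>2 \<le> 16 * (p1 * (1 - p2)) * (p2 * (1 - p1))"
    and ne: "(1 - p1) * (1 - p2) \<noteq> p1 * p2 * (exp t)\<^sup>2"
  obtains c where "c > 0"
    "skew p1 t + skew p2 t = c * ((1 - p1) * (1 - p2) - p1 * p2 * (exp t)\<^sup>2)"
proof -
  define x a b where "x = exp t" and "a = 1 - p1" and "b = 1 - p2"
  have pos: "x > 0" "a > 0" "b > 0" using p by (auto simp: x_def a_def b_def)
  define n1 n2 where "n1 = a + p1 * x" and "n2 = b + p2 * x"
  have n: "n1 > 0" "n2 > 0" using p pos by (auto simp: n1_def n2_def add_pos_pos)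
  define r where "r = (p1 * b + p2 * a) * (a * b + p1 * p2 * x\<^sup>2) +
    (8 * (p1 * b) * (p2 * a) - (p1 * b + p2 * a)\<^sup>2) * x"
  have r: "r > 0"
    unfolding r_def by (rule skewness_factor_pos) (use p pos le ne in \<open>auto simp: x_def a_def b_def\<close>)
  have "skew p1 t + skew p2 t =
      x * (p1 * a * (a - p1 * x)) / n1 ^ 3 + x * (p2 * b * (b - p2 * x)) / n2 ^ 3"
    using p by (simp add: skew_eq n1_def n2_def x_def a_def b_def)
  also have "\<dots> = x * (p1 * a * (a - p1 * x) * n2 ^ 3 + p2 * b * (b - p2 * x) * n1 ^ 3) / (n1 ^ 3 * n2 ^ 3)"
    using n by (simp add: add_frac_eq algebra_simps)
  also have "\<dots> = x * r / (n1 ^ 3 * n2 ^ 3) * (a * b - p1 * p2 * x\<^sup>2)"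
    unfolding n1_def n2_def skewness_numerator r_def by simp
  finally have "skew p1 t + skew p2 t = x * r / (n1 ^ 3 * n2 ^ 3) * (a * b - p1 * p2 * x\<^sup>2)" .
  moreover have "x * r / (n1 ^ 3 * n2 ^ 3) > 0" using n r pos by simp
  ultimately show ?thesis using that unfolding x_def a_def b_def by blast
qed

section \<open>The set \<open>D\<close>\<close>

lemma D_polynomial:
  fixes p1 p2 :: real
  shows "12 * p1 * p2 * (p1 + p2 - p1 * p2) - 14 * p1 * p2 + p1\<^sup>2 + p2\<^sup>2 =
    (p1 * (1 - p2) + p2 * (1 - p1))\<^sup>2 - 16 * (p1 * (1 - p2)) * (p2 * (1 - p1))"
  by (simp add: algebra_simps power2_eq_square)

text \<open>On an edge of the square one of \<open>p1 * (1 - p2)\<close>,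
  \<open>p2 * (1 - p1)\<close> is zero; the inequality then makes the other zero too, which leaves
  only the two excluded corners.\<close>

lemma D_interior:
  assumes "(p1, p2) \<in> D - {(0, 0), (1, 1)}"
  shows "0 < p1" "p1 < 1" "0 < p2" "p2 < 1"
proof -
  have D: "0 \<le> p1" "p1 \<le> 1" "0 \<le> p2" "p2 \<le> 1"
      "(p1 * (1 - p2) + p2 * (1 - p1))\<^sup>2 \<le> 16 * (p1 * (1 - p2)) * (p2 * (1 - p1))"
    using assms unfolding D_def D_polynomial by auto
  have "p1 \<noteq> 0" "p1 \<noteq> 1" "p2 \<noteq> 0" "p2 \<noteq> 1"
    using D(5) assms by auto
  then show "0 < p1" "p1 < 1" "0 < p2" "p2 < 1"
    using D by auto
qed

text \<open>The form \<open>u\<^sup>2 - 14 * u * v + v\<^sup>2\<close> has the roots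
  \<open>7 + 4 * sqrt 3\<close> and \<open>7 - 4 * sqrt 3\<close> in \<open>u / v\<close>. They are
  reciprocal, so the lower bound on \<open>u\<close> becomes an upper bound on
  \<open>v\<close>.\<close>

lemma quadratic_cone:
  fixes u v :: real
  assumes "u \<ge> 0" "v \<ge> 0"
  shows "(u + v)\<^sup>2 \<le> 16 * u * v \<longleftrightarrow> u \<le> (7 + 4 * sqrt 3) * v \<and> v \<le> (7 + 4 * sqrt 3) * u"
proof -
  define k l where "k = 7 + 4 * sqrt 3" and "l = 7 - 4 * sqrt 3"
  have kl: "k * l = 1" "k + l = 14" and k: "k > 0"
    by (simp_all add: k_def l_def algebra_simps add_pos_nonneg)
  have "(u + v)\<^sup>2 - 16 * u * v = u\<^sup>2 - (k + l) * (u * v) + (k * l) * v\<^sup>2"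
    unfolding kl by (simp add: power2_eq_square algebra_simps)
  also have "\<dots> = (u - k * v) * (u - l * v)"
    by (simp add: power2_eq_square algebra_simps)
  finally have "(u + v)\<^sup>2 \<le> 16 * u * v \<longleftrightarrow> (u - k * v) * (u - l * v) \<le> 0"
    by linarith
  also have "\<dots> \<longleftrightarrow> u \<le> k * v \<and> l * v \<le> u"
  proof -
    have "l * v \<le> k * v" using assms by (intro mult_right_mono) (auto simp: k_def l_def)
    then show ?thesis by (auto simp: mult_le_0_iff)
  qed
  also have "l * v \<le> u \<longleftrightarrow> v \<le> k * u"
  proof -
    have "l * v \<le> u \<longleftrightarrow> k * (l * v) \<le> k * u" using k by simp
    also have "k * (l * v) = v" using kl by (simp flip: mult.assoc)
    finally show ?thesis .
  qed
  finally show ?thesis unfolding k_def .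
qed

lemma closed_D: "closed D"
proof -
  have "D = ({0..1} \<times> {0..1}) \<inter> {z. 12 * fst z * snd z * (fst z + snd z - fst z * snd z)
      - 14 * fst z * snd z + (fst z)\<^sup>2 + (snd z)\<^sup>2 \<le> 0}"
    by (auto simp: D_def)
  also have "closed \<dots>"
    by (intro closed_Int closed_Times closed_Collect_le continuous_intros)
  finally show ?thesis .
qed

text \<open>The inequality \<open>y (1 - x) \<le> k x (1 - y)\<close> describes the hypograph of
  \<open>k / (k - 1) (1 - 1 / (1 + (k - 1) x))\<close>.\<close>

lemma convex_odds_ratio:
  fixes k :: real
  assumes k: "k > 1"
  shows "convex {(x, y). 0 \<le> x \<and> y * (1 - x) \<le> k * (x * (1 - y))}"
proof -
  have conv: "convex_on {0..} (\<lambda>x::real. k / (k - 1) * inverse (1 + (k - 1) * x))"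
  proof -
    have "convex_on {0<..} (inverse :: real \<Rightarrow> real)" by (intro convex_on_inverse) auto
    have "convex_on {0..} (\<lambda>x. inverse (1 + (k - 1) * x))"
    proof (rule convex_onI)
      fix t x y :: real
      assume t: "0 < t" "t < 1" and xy: "x \<in> {0..}" "y \<in> {0..}"
      let ?e = "\<lambda>x. 1 + (k - 1) * x"
      have pos: "?e x > 0" "?e y > 0" using xy k by (auto simp: add_pos_nonneg)
      have "inverse ((1 - t) *\<^sub>R ?e x + t *\<^sub>R ?e y) \<le> (1 - t) * inverse (?e x) + t * inverse (?e y)"
        by (rule convex_onD[OF \<open>convex_on {0<..} inverse\<close>]) (use t pos in auto)
      also have "(1 - t) *\<^sub>R ?e x + t *\<^sub>R ?e y = ?e ((1 - t) *\<^sub>R x + t *\<^sub>R y)"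
        by (simp add: algebra_simps)
      finally show "inverse (?e ((1 - t) *\<^sub>R x + t *\<^sub>R y))
          \<le> (1 - t) * inverse (?e x) + t * inverse (?e y)" .
    qed auto
    then show ?thesis
      using k by (intro convex_on_cmul) auto
  qed
  \<comment> \<open>Clearing the positive denominator \<open>1 + (k - 1) * x\<close> shows that the
    condition bounds \<open>y\<close> above by a concave function of \<open>x\<close>.\<close>
  have iff: "y * (1 - x) \<le> k * (x * (1 - y)) \<longleftrightarrow>
      k / (k - 1) * inverse (1 + (k - 1) * x) \<le> k / (k - 1) - y" if "0 \<le> x" for x y
  proof -
    have e: "1 + (k - 1) * x > 0" using that k by (simp add: add_pos_nonneg)
    have "k / (k - 1) * inverse (1 + (k - 1) * x) \<le> k / (k - 1) - y \<longleftrightarrow>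
        k / (k - 1) \<le> (k / (k - 1) - y) * (1 + (k - 1) * x)"
      unfolding divide_inverse[of _ "1 + (k - 1) * x", symmetric]
      using e by (rule pos_divide_le_eq)
    also have "(k / (k - 1) - y) * (1 + (k - 1) * x) =
        k / (k - 1) + (k * (x * (1 - y)) - y * (1 - x))"
      using k by (simp add: field_simps)
    finally show ?thesis by auto
  qed
  show ?thesis (is "convex ?H")
  proof (rule convexI)
    fix z z' and a b :: real
    assume zH: "z \<in> ?H" "z' \<in> ?H" and ab: "0 \<le> a" "0 \<le> b" "a + b = 1"
    obtain x y x' y' where z: "z = (x, y)" "z' = (x', y')" by fastforce
    with zH have H: "0 \<le> x" "y * (1 - x) \<le> k * (x * (1 - y))"
      "0 \<le> x'" "y' * (1 - x') \<le> k * (x' * (1 - y'))"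
      by auto
    let ?f = "\<lambda>x::real. k / (k - 1) * inverse (1 + (k - 1) * x)"
    have nn: "0 \<le> a * x + b * x'" using H ab by auto
    have a: "a = 1 - b" using ab by simp
    have "?f (a * x + b * x') \<le> a * ?f x + b * ?f x'"
      using convex_onD[OF conv, of b x x'] H ab unfolding a by auto
    also have "\<dots> \<le> a * (k / (k - 1) - y) + b * (k / (k - 1) - y')"
      using H ab iff by (intro add_mono mult_left_mono) auto
    also have "\<dots> = (a + b) * (k / (k - 1)) - (a * y + b * y')" by (simp only: algebra_simps)
    also have "\<dots> = k / (k - 1) - (a * y + b * y')" by (simp add: ab)
    finally have "(a * y + b * y') * (1 - (a * x + b * x'))
        \<le> k * ((a * x + b * x') * (1 - (a * y + b * y')))"
      using iff[OF nn] by blast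
    with nn show "a *\<^sub>R z + b *\<^sub>R z' \<in> ?H"
      by (simp add: z)
  qed
qed

lemma convex_D: "convex D"
proof -
  define k :: real where "k = 7 + 4 * sqrt 3"
  have k: "k > 1" by (simp add: k_def add_pos_nonneg)
  define A where "A = {(x, y). 0 \<le> x \<and> y * (1 - x) \<le> k * (x * (1 - y))}"
  \<comment> \<open>The two odds ratio bounds are mirror images, so one convexity result serves
    both.\<close>
  have "linear (prod.swap :: real \<times> real \<Rightarrow> _)"
    by (rule linearI) auto
  then have "convex (prod.swap -` A)"
    unfolding A_def using convex_odds_ratio[OF k] by (rule convex_linear_vimage)
  then have "convex (({0..1} \<times> {0..1}) \<inter> (A \<inter> prod.swap -` A))"
    unfolding A_def using convex_odds_ratio[OF k] by (intro convex_Int convex_Times) auto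
  also have "({0..1} \<times> {0..1}) \<inter> (A \<inter> prod.swap -` A) = D"
  proof (rule set_eqI, clarify)
    fix x y :: real
    show "(x, y) \<in> ({0..1} \<times> {0..1}) \<inter> (A \<inter> prod.swap -` A) \<longleftrightarrow> (x, y) \<in> D"
    proof (cases "x \<in> {0..1} \<and> y \<in> {0..1}")
      case True
      then have "(x, y) \<in> D \<longleftrightarrow> (x * (1 - y) + y * (1 - x))\<^sup>2 \<le> 16 * (x * (1 - y)) * (y * (1 - x))"
        unfolding D_def D_polynomial by auto
      also have "\<dots> \<longleftrightarrow> x * (1 - y) \<le> k * (y * (1 - x)) \<and> y * (1 - x) \<le> k * (x * (1 - y))"
        unfolding k_def by (rule quadratic_cone) (use True in auto)
      finally show ?thesis using True by (auto simp: A_def)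
    qed (auto simp: D_def)
  qed
  finally show ?thesis .
qed

section \<open>Unimodality on \<open>D\<close>\<close>

lemma tstar_odds:
  assumes "0 < p1" "p1 < 1" "0 < p2" "p2 < 1"
  defines "t \<equiv> ln ((1 - p1) / p1 * ((1 - p2) / p2))"
  shows "exp t = (1 - p1) * (1 - p2) / (p1 * p2)"
    and "p1 + p2 \<le> 1 \<longleftrightarrow> 0 \<le> t"
    and "t * (tilt p1 t - p1 + (tilt p2 t - p2)) = 2 * (cumulant p1 t + cumulant p2 t)"
proof -
  have pos: "(1 - p1) / p1 * ((1 - p2) / p2) > 0" using assms by simp
  then show e: "exp t = (1 - p1) * (1 - p2) / (p1 * p2)"
    unfolding t_def by simp
  have "0 \<le> t \<longleftrightarrow> 1 \<le> (1 - p1) * (1 - p2) / (p1 * p2)"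
    using e one_le_exp_iff by metis
  also have "\<dots> \<longleftrightarrow> p1 * p2 \<le> (1 - p1) * (1 - p2)" using assms by (simp add: le_divide_eq)
  also have "\<dots> \<longleftrightarrow> p1 + p2 \<le> 1" by (auto simp: algebra_simps)
  finally show "p1 + p2 \<le> 1 \<longleftrightarrow> 0 \<le> t" by blast
  have m: "1 + p1 * (exp t - 1) = (1 - p1) / p2" "1 + p2 * (exp t - 1) = (1 - p2) / p1"
    unfolding e using assms by (simp_all add: field_simps)
  \<comment> \<open>Tilting by this \<open>t\<close> turns each probability into the complement of
    the other, so both sides of the last claim equal \<open>2 * t * (1 - p1 - p2)\<close>.\<close>
  have T: "tilt p1 t = 1 - p2" "tilt p2 t = 1 - p1"
    unfolding tilt_def m unfolding e using assms by simp_all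
  have "ln ((1 - p1) / p2) + ln ((1 - p2) / p1) = t"
    unfolding t_def using assms by (simp add: ln_mult_pos ln_div)
  then have "cumulant p1 t + cumulant p2 t = t * (1 - p1 - p2)"
    unfolding cumulant_def m by (simp add: algebra_simps)
  then show "t * (tilt p1 t - p1 + (tilt p2 t - p2)) = 2 * (cumulant p1 t + cumulant p2 t)"
    unfolding T by (simp add: algebra_simps)
qed

lemma g_deriv_sign_nonneg:
  assumes p: "0 < p1" "p1 < 1" "0 < p2" "p2 < 1" "p1 + p2 \<le> 1"
    and le: "(p1 * (1 - p2) + p2 * (1 - p1))\<^sup>2 \<le> 16 * (p1 * (1 - p2)) * (p2 * (1 - p1))"
  defines "ts \<equiv> ln ((1 - p1) / p1 * ((1 - p2) / p2))"
  obtains g' where "\<And>t. (g p1 p2 has_real_derivative g' t) (at t)"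
    "\<And>t. t < ts \<Longrightarrow> g' t > 0" "\<And>t. t > ts \<Longrightarrow> g' t < 0"
proof -
  let ?f = "\<lambda>t. cumulant p1 t + cumulant p2 t"
  let ?f1 = "\<lambda>t. (tilt p1 t - p1) + (tilt p2 t - p2)"
  let ?f2 = "\<lambda>t. tilt p1 t * (1 - tilt p1 t) + tilt p2 t * (1 - tilt p2 t)"
  let ?f3 = "\<lambda>t. skew p1 t + skew p2 t"
  note ts = tstar_odds[OF p(1-4), folded ts_def]
  have fac: "(1 - p1) * (1 - p2) - p1 * p2 * (exp t)\<^sup>2 = p1 * p2 * (exp ts - exp (2 * t))" for t
    unfolding exp_double ts(1) using p by (simp add: field_simps)
  \<comment> \<open>The third derivative thus changes sign exactly at \<open>ts / 2\<close>, which
    takes the role of \<open>m\<close>.\<close>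
  have f3: "\<exists>c>0. ?f3 t = c * (exp ts - exp (2 * t))" if "t \<noteq> ts / 2" for t
  proof -
    have "exp ts \<noteq> exp (2 * t)" using that by auto
    then have "(1 - p1) * (1 - p2) \<noteq> p1 * p2 * (exp t)\<^sup>2" using fac[of t] p by auto
    then obtain c where c: "c > 0" "?f3 t = c * (p1 * p2 * (exp ts - exp (2 * t)))"
      using skew_sum[OF p(1-4) le, of t] fac[of t] by metis
    then show ?thesis using p by (intro exI[of _ "c * (p1 * p2)"]) simp
  qed
  interpret third_derivative_sign ?f ?f1 ?f2 ?f3 "ts / 2"
  proof
    show "(?f has_real_derivative ?f1 t) (at t)" for t
      using p by (intro DERIV_add cumulant_deriv) auto
    show "(?f1 has_real_derivative ?f2 t) (at t)" for t
      using p by (auto intro!: derivative_eq_intros tilt_deriv)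
    show "(?f2 has_real_derivative ?f3 t) (at t)" for t
      using p by (intro DERIV_add variance_deriv) auto
    show "?f3 t > 0" if lt: "t < ts / 2" for t
    proof -
      obtain c where "c > 0" "?f3 t = c * (exp ts - exp (2 * t))" using f3[OF less_imp_neq[OF lt]] by blast
      then show ?thesis using lt by simp
    qed
    show "?f3 t < 0" if gt: "t > ts / 2" for t
    proof -
      obtain c where "c > 0" "?f3 t = c * (exp ts - exp (2 * t))" using f3[OF less_imp_neq[OF gt, symmetric]] by blast
      then show ?thesis using gt by (simp add: mult_less_0_iff)
    qed
  qed (use ts p in \<open>simp_all add: cumulant_0 tilt_0\<close>)
  have eq: "g p1 p2 = G"
    using p by (auto simp: fun_eq_iff g_eq G_def tilt_0)
  obtain G' where "\<And>t. (G has_real_derivative G' t) (at t)"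
    "\<And>t. t < ts \<Longrightarrow> G' t > 0" "\<And>t. t > ts \<Longrightarrow> G' t < 0"
    using G_unimodal by auto
  then show ?thesis
    by (intro that[of G', unfolded eq])
qed

text \<open>Replacing each \<open>p\<close> by \<open>1 - p\<close> swaps
  \<open>p1 * (1 - p2)\<close> with \<open>p2 * (1 - p1)\<close>, which preserves \<open>le\<close>,
  negates \<open>ts\<close> and mirrors \<open>g\<close>.\<close>

lemma g_deriv_sign:
  assumes p: "0 < p1" "p1 < 1" "0 < p2" "p2 < 1"
    and le: "(p1 * (1 - p2) + p2 * (1 - p1))\<^sup>2 \<le> 16 * (p1 * (1 - p2)) * (p2 * (1 - p1))"
  defines "ts \<equiv> ln ((1 - p1) / p1 * ((1 - p2) / p2))"
  obtains g' where "\<And>t. (g p1 p2 has_real_derivative g' t) (at t)"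
    "\<And>t. t < ts \<Longrightarrow> g' t > 0" "\<And>t. t > ts \<Longrightarrow> g' t < 0"
proof (cases "p1 + p2 \<le> 1")
  case True
  then show ?thesis
    using g_deriv_sign_nonneg[OF p True le] that unfolding ts_def by blast
next
  case False
  have le': "((1 - p1) * (1 - (1 - p2)) + (1 - p2) * (1 - (1 - p1)))\<^sup>2
      \<le> 16 * ((1 - p1) * (1 - (1 - p2))) * ((1 - p2) * (1 - (1 - p1)))"
    using le by (simp add: algebra_simps)
  have ts: "ln ((1 - (1 - p1)) / (1 - p1) * ((1 - (1 - p2)) / (1 - p2))) = - ts"
    unfolding ts_def using p by (simp add: ln_mult_pos ln_div)
  obtain g' where g': "\<And>t. (g (1 - p1) (1 - p2) has_real_derivative g' t) (at t)"
    "\<And>t. t < - ts \<Longrightarrow> g' t > 0" "\<And>t. t > - ts \<Longrightarrow> g' t < 0"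
    using g_deriv_sign_nonneg[OF _ _ _ _ _ le'] p False unfolding ts by auto
  have eq: "g p1 p2 = (\<lambda>t. g (1 - p1) (1 - p2) (- t))"
    using p by (simp add: g_reflect)
  show ?thesis
  proof (rule that[of "\<lambda>t. - g' (- t)"])
    show "(g p1 p2 has_real_derivative - g' (- t)) (at t)" for t
      unfolding eq using g'(1)[of "- t"] by (simp add: DERIV_mirror)
  qed (use g' in auto)
qed

theorem theorem1p3:
  shows "closed D \<and> convex D \<and> D - {(0, 0), (1, 1)} \<subseteq> C \<and>
         (\<forall>(p1, p2) \<in> D - {(0, 0), (1, 1)}. strictly_unimodal (g p1 p2))"
proof -
  have "(p1, p2) \<in> C \<and> strictly_unimodal (g p1 p2)"
    if D: "(p1, p2) \<in> D - {(0, 0), (1, 1)}" for p1 p2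
  proof -
    note p = D_interior[OF D]
    define ts where "ts = ln ((1 - p1) / p1 * ((1 - p2) / p2))"
    have le: "(p1 * (1 - p2) + p2 * (1 - p1))\<^sup>2 \<le> 16 * (p1 * (1 - p2)) * (p2 * (1 - p1))"
      using D unfolding D_def D_polynomial by auto
    obtain g' where g': "\<And>t. (g p1 p2 has_real_derivative g' t) (at t)"
      "\<And>t. t < ts \<Longrightarrow> g' t > 0" "\<And>t. t > ts \<Longrightarrow> g' t < 0"
      using g_deriv_sign[OF p le] unfolding ts_def by blast
    have deriv: "deriv (g p1 p2) t = g' t" for t
      using g'(1) by (rule DERIV_imp_deriv)
    have uni: "strictly_unimodal (g p1 p2)"
      unfolding strictly_unimodal_def deriv
      using g' real_differentiable_def by blast
    \<comment> \<open>Both probabilities lie strictly inside the unit interval, so the infinite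
      values do not occur.\<close>
    have "tstar p1 p2 = ereal ts"
      using p by (auto simp: tstar_def ts_def)
    then have "(p1, p2) \<in> C"
      unfolding C_def using p uni g' by (auto simp: deriv)
    with uni show ?thesis by blast
  qed
  then show ?thesis
    using closed_D convex_D by auto
qed

end
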